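(* Let $\theta$ be any solution of $$(s^{\delta}(\theta')^k)'+s^{\delta}\big(bs\theta'+\kappa\theta+c_{n,k}^{-1}|\theta|^{q-1}\theta\big)=0\quad\text{in }(0,\infty)$$ such that $\tilde L=\lim_{s\to\infty}s^{\tilde\kappa}\theta(s)>0$, where $\tilde\kappa=\frac{\kappa}{b}$. Then $$\lim_{s\to\infty}s^{\tilde\kappa+1}\theta'(s)=-\tilde\kappa\tilde L,$$ and, as $s\to\infty$, $$\theta(s)=\begin{cases} s^{-\tilde\kappa}\big(\tilde L+(\tilde A+o(1))s^{-\tilde\nu}\big),&\text{if }(q-k)\tilde\kappa>k+1,\\ s^{-\tilde\kappa}\big(\tilde L+(\tilde A+\tilde B+o(1))s^{-\tilde\kappa(q-1)}\big),&\text{if }(q-k)\tilde\kappa=k+1,\\ s^{-\tilde\kappa}\big(\tilde L+(\tilde B+o(1))s^{-\tilde\kappa(q-1)}\big),&\text{if }(q-k)\tilde\kappa<k+1, \end{cases}$$ where $$\tilde\nu=(k-1)\tilde\kappa+k+1,\quad \tilde A=\frac{(k\tilde\kappa-(\tilde n-(k+1)))(\tilde\kappa\tilde L)^k}{b\tilde\nu},\quad \tilde B=\frac{\tilde L^q}{b\,c_{n,k}\,\tilde\kappa(q-1)} .$$ Moreover, differentiating term by term gives an expansion of $\theta'$; that is, as $s\to\infty$, $$\theta'(s)=\begin{cases} -s^{-(\tilde\kappa+1)}\big(\tilde\kappa\tilde L+(\tilde\kappa+\tilde\nu)(\tilde A+o(1))s^{-\tilde\nu}\big),&\text{if }(q-k)\tilde\kappa>k+1,\\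 -s^{-(\tilde\kappa+1)}\big(\tilde\kappa\tilde L+\tilde\kappa q(\tilde A+\tilde B+o(1))s^{-\tilde\kappa(q-1)}\big),&\text{if }(q-k)\tilde\kappa=k+1,\\ -s^{-(\tilde\kappa+1)}\big(\tilde\kappa\tilde L+\tilde\kappa q(\tilde B+o(1))s^{-\tilde\kappa(q-1)}\big),&\text{if }(q-k)\tilde\kappa<k+1. \end{cases}$$
   Context: Here $n>2$ and $1\le k\le n$ are integers with $k$ odd, $q>k$ and $\kappa>0$ are real, $c_{n,k}=\frac1n\binom nk$, $b=\frac{2k}{k+1}$, $\delta=\frac{n(k+1)-2k}{2k}$, and $\tilde n=\delta+1=\frac{n(k+1)}{2k}$. A solution of the equation is a function $\theta\in C^1((0,\infty))$ with $(\theta')^k\in C^1((0,\infty))$ satisfying the equation pointwise. *)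

theory Defs
  imports "HOL-Analysis.Analysis" "HOL-Library.Landau_Symbols"
begin

definition c_coeff :: "nat \<Rightarrow> nat \<Rightarrow> real" where
  "c_coeff n k = 1 / real n * real (n choose k)"

definition b_coeff :: "nat \<Rightarrow> real" where
  "b_coeff k = 2 * real k / (real k + 1)"

definition delta_exp :: "nat \<Rightarrow> nat \<Rightarrow> real" where
  "delta_exp n k = (real n * (real k + 1) - 2 * real k) / (2 * real k)"

definition n_tilde :: "nat \<Rightarrow> nat \<Rightarrow> real" where
  "n_tilde n k = delta_exp n k + 1"

definition kappa_tilde :: "nat \<Rightarrow> real \<Rightarrow> real" where
  "kappa_tilde k \<kappa> = \<kappa> / b_coeff k"

definition nu_tilde :: "nat \<Rightarrow> real \<Rightarrow> real" where
  "nu_tilde k \<kappa> = (real k - 1) * kappa_tilde k \<kappa> + real k + 1"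

definition A_tilde :: "nat \<Rightarrow> nat \<Rightarrow> real \<Rightarrow> real \<Rightarrow> real" where
  "A_tilde n k \<kappa> L =
     (real k * kappa_tilde k \<kappa> - (n_tilde n k - (real k + 1))) * (kappa_tilde k \<kappa> * L) ^ k
       / (b_coeff k * nu_tilde k \<kappa>)"

definition B_tilde :: "nat \<Rightarrow> nat \<Rightarrow> real \<Rightarrow> real \<Rightarrow> real \<Rightarrow> real" where
  "B_tilde n k q \<kappa> L =
     L powr q / (b_coeff k * c_coeff n k * kappa_tilde k \<kappa> * (q - 1))"

text \<open>Only the values of \<open>\<theta>\<close> on \<open>(0, \<infinity>)\<close> matter, as this set is open; nothing is
  required at or below \<open>0\<close>.\<close>

definition is_solution :: "nat \<Rightarrow> nat \<Rightarrow> real \<Rightarrow> real \<Rightarrow> (real \<Rightarrow> real) \<Rightarrow> bool" where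
  "is_solution n k q \<kappa> \<theta> \<longleftrightarrow>
     \<theta> C1_differentiable_on {0<..} \<and>
     (\<lambda>s. deriv \<theta> s ^ k) C1_differentiable_on {0<..} \<and>
     (\<forall>s>0. deriv (\<lambda>t. t powr delta_exp n k * deriv \<theta> t ^ k) s
        + s powr delta_exp n k *
            (b_coeff k * s * deriv \<theta> s + \<kappa> * \<theta> s
              + inverse (c_coeff n k) * \<bar>\<theta> s\<bar> powr (q - 1) * \<theta> s) = 0)"

end

theory Submission imports Defs begin

text \<open>
  Put \<open>v = s\<^sup>p \<theta>\<close> and \<open>y = s\<^bsup>p+1\<^esup> \<theta>'\<close> with \<open>p\<close> the decay rate. The flux \<open>(\<theta>')\<^sup>k\<close> satisfies a
  first-order equation in which the term \<open>b s \<theta>'\<close> dominates and is dissipative. Hence \<open>\<theta>'\<close> is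
  bounded, which makes \<open>y\<^sup>k\<close> obey \<open>(y\<^sup>k)' = s\<^bsup>\<nu>-1\<^esup> (- b p L - b y + o(1) + o(1) y)\<close>, and the equilibrium
  \<open>y = - p L\<close> attracts all solutions. In particular \<open>\<theta>' < 0\<close> for large \<open>s\<close>, so \<open>y\<close> itself is
  differentiable there. For the next order one looks at \<open>E = s\<^sup>\<tau> (y + p v) = s\<^bsup>\<tau>+1\<^esup> v'\<close>, which again
  satisfies a first-order equation with an attracting equilibrium. Its limit gives the expansion of
  \<open>\<theta>\<close> by integration and that of \<open>\<theta>'\<close> through \<open>y = s v' - p v\<close>; no asymptotics of \<open>\<theta>''\<close> are
  needed.
\<close>

section \<open>Comparison arguments for real functions at infinity\<close>

text \<open>If \<open>f\<close> stayed at or above \<open>m\<close>, it would fall at rate at least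
  \<open>c\<close> and cross \<open>m\<close>. Once below, it cannot return: at a first return the
  derivative is negative, so values just before would already lie above \<open>m\<close>.\<close>

lemma eventually_less_of_descent:
  fixes f D :: "real \<Rightarrow> real"
  assumes der: "\<forall>\<^sub>F s in at_top. (f has_real_derivative D s) (at s)"
    and desc: "\<forall>\<^sub>F s in at_top. m \<le> f s \<longrightarrow> D s \<le> - c"
    and c: "c > 0"
  shows "\<forall>\<^sub>F s in at_top. f s < m"
proof -
  from eventually_conj[OF der desc] obtain N where
    N: "\<And>s. s \<ge> N \<Longrightarrow> (f has_real_derivative D s) (at s)"
       "\<And>s. s \<ge> N \<Longrightarrow> m \<le> f s \<Longrightarrow> D s \<le> - c"
    by (auto simp: eventually_at_top_linorder)
  have "\<exists>s\<ge>N. f s < m"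
  proof (rule ccontr)
    assume "\<not> ?thesis"
    hence ge: "m \<le> f s" if "s \<ge> N" for s using that by force
    \<comment> \<open>Falling at rate \<open>c\<close> for time \<open>T\<close> takes
      \<open>f\<close> from \<open>f N\<close> to \<open>m - c\<close> or lower.\<close>
    define T where "T = (f N - m) / c + 1"
    have T: "T > 0" using ge[of N] c by (simp add: T_def add_nonneg_pos)
    obtain \<xi> where \<xi>: "\<xi> > N" "\<xi> < N + T" "f (N + T) - f N = (N + T - N) * D \<xi>"
      using MVT2[of N "N + T" f D] T N(1) by auto
    have "D \<xi> \<le> - c" using N(2) ge \<xi> by simp
    hence "T * D \<xi> \<le> T * (- c)" using T by (intro mult_left_mono) auto
    also have "\<dots> = m - f N - c" using c by (simp add: T_def field_simps)
    finally have "f (N + T) < m" using \<xi>(3) c by simp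
    with ge[of "N + T"] T show False by simp
  qed
  then obtain a where a: "a \<ge> N" "f a < m" by blast
  have "f s < m" if s: "s \<ge> a" for s
  proof (rule ccontr)
    assume "\<not> f s < m"
    \<comment> \<open>Continuity makes the set \<open>S\<close> of times with values at or above
      \<open>m\<close> compact, so it has a first element \<open>t\<close>.\<close>
    define S where "S = {a..s} \<inter> f -` {m..}"
    have cont: "continuous_on {a..s} f"
      using N(1) a(1) by (intro DERIV_atLeastAtMost_imp_continuous_on) (metis order_trans)
    have "closed S"
      unfolding S_def by (rule continuous_closed_preimage[OF cont]) auto
    hence "compact S"
      unfolding S_def by (metis compact_Icc compact_Int_closed inf.left_idem)
    moreover have "s \<in> S" using \<open>\<not> f s < m\<close> s by (auto simp: S_def)
    ultimately obtain t where t: "t \<in> S" "\<And>r. r \<in> S \<Longrightarrow> t \<le> r"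
      using compact_attains_inf[of S] by blast
    have ta: "a < t" using t(1) a(2) by (cases "t = a") (auto simp: S_def)
    have "D t < 0" using N(2)[of t] t(1) a(1) c by (auto simp: S_def)
    then obtain d where d: "d > 0" "\<And>h. h > 0 \<Longrightarrow> h < d \<Longrightarrow> f t < f (t - h)"
      using DERIV_neg_dec_left[OF N(1)[of t]] ta a(1) by auto
    define h where "h = min (d / 2) (t - a)"
    have h: "h > 0" "h < d" "h \<le> t - a" using d(1) ta by (auto simp: h_def min_def)
    have "t - h \<in> S" using d(2)[OF h(1,2)] t(1) h by (auto simp: S_def)
    from t(2)[OF this] h(1) show False by simp
  qed
  thus ?thesis by (auto simp: eventually_at_top_linorder)
qed

text \<open>For \<open>a > l\<close> the bracket at level \<open>a\<close> tends to the negative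
  number \<open>\<beta>\<^sub>0 * (\<phi> l - \<phi> a)\<close>. Monotonicity of
  \<open>\<phi>\<close> carries the sign to every \<open>f s \<ge> a\<close>, and
  \<open>g s \<ge> 1\<close> keeps the descent rate away from zero, so \<open>f\<close> ends below
  \<open>a\<close>; levels below \<open>l\<close> are symmetric. \<open>\<phi>\<close> is later
  \<open>root k\<close>, then the identity.\<close>

lemma tendsto_attracting_equilibrium:
  fixes f D g \<beta> \<gamma> \<phi> :: "real \<Rightarrow> real"
  assumes der: "\<forall>\<^sub>F s in at_top. (f has_real_derivative D s) (at s)"
    and D: "\<forall>\<^sub>F s in at_top. D s = g s * (\<gamma> s - \<beta> s * \<phi> (f s))"
    and g: "\<forall>\<^sub>F s in at_top. g s \<ge> 1"
    and \<beta>: "(\<beta> \<longlongrightarrow> \<beta>\<^sub>0) at_top" and \<beta>0: "\<beta>\<^sub>0 > 0"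
    and \<gamma>: "(\<gamma> \<longlongrightarrow> \<beta>\<^sub>0 * \<phi> l) at_top"
    and \<phi>: "strict_mono \<phi>"
  shows "(f \<longlongrightarrow> l) at_top"
proof (rule order_tendstoI)
  have lim: "((\<lambda>s. \<gamma> s - \<beta> s * \<phi> a) \<longlongrightarrow> \<beta>\<^sub>0 * (\<phi> l - \<phi> a)) at_top" for a
    using tendsto_diff[OF \<gamma> tendsto_mult[OF \<beta> tendsto_const[of "\<phi> a"]]]
    by (simp add: algebra_simps)
  have \<beta>pos: "\<forall>\<^sub>F s in at_top. \<beta> s > 0" using order_tendstoD(1)[OF \<beta> \<beta>0] .
  {
    fix a assume a: "l < a"
    \<comment> \<open>Half the limiting gap leaves room for the bracket to settle below
      \<open>- c\<close>.\<close>
    define c where "c = \<beta>\<^sub>0 * (\<phi> a - \<phi> l) / 2"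
    have pos: "\<beta>\<^sub>0 * (\<phi> a - \<phi> l) > 0" using \<beta>0 strict_monoD[OF \<phi> a] by simp
    have c: "c > 0" using pos by (simp add: c_def)
    have "\<beta>\<^sub>0 * (\<phi> l - \<phi> a) < - c" using pos by (simp add: c_def field_simps)
    from order_tendstoD(2)[OF lim this] D g \<beta>pos
    have "\<forall>\<^sub>F s in at_top. a \<le> f s \<longrightarrow> D s \<le> - c"
    proof eventually_elim
      case (elim s)
      show ?case
      proof
        assume "a \<le> f s"
        hence "\<beta> s * \<phi> a \<le> \<beta> s * \<phi> (f s)"
          using elim(4) \<phi> by (simp add: strict_mono_less_eq)
        hence *: "\<gamma> s - \<beta> s * \<phi> (f s) \<le> - c" using elim(1) by linarith
        hence "g s * (\<gamma> s - \<beta> s * \<phi> (f s)) \<le> 1 * (\<gamma> s - \<beta> s * \<phi> (f s))"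
          using elim(3) c by (intro mult_right_mono_neg) auto
        thus "D s \<le> - c" using * elim(2) by simp
      qed
    qed
    from eventually_less_of_descent[OF der this c]
    show "\<forall>\<^sub>F s in at_top. f s < a" .
  next
    fix a assume a: "a < l"
    define c where "c = \<beta>\<^sub>0 * (\<phi> l - \<phi> a) / 2"
    have pos: "\<beta>\<^sub>0 * (\<phi> l - \<phi> a) > 0" using \<beta>0 strict_monoD[OF \<phi> a] by simp
    have c: "c > 0" using pos by (simp add: c_def)
    have "c < \<beta>\<^sub>0 * (\<phi> l - \<phi> a)" using pos by (simp add: c_def field_simps)
    from order_tendstoD(1)[OF lim this] D g \<beta>pos
    have "\<forall>\<^sub>F s in at_top. - a \<le> - f s \<longrightarrow> - D s \<le> - c"
    proof eventually_elim
      case (elim s)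
      show ?case
      proof
        assume "- a \<le> - f s"
        hence "\<beta> s * \<phi> (f s) \<le> \<beta> s * \<phi> a"
          using elim(4) \<phi> by (simp add: strict_mono_less_eq)
        hence *: "c \<le> \<gamma> s - \<beta> s * \<phi> (f s)" using elim(1) by linarith
        hence "1 * (\<gamma> s - \<beta> s * \<phi> (f s)) \<le> g s * (\<gamma> s - \<beta> s * \<phi> (f s))"
          using elim(3) c by (intro mult_right_mono) auto
        thus "- D s \<le> - c" using * elim(2) by simp
      qed
    qed
    moreover have "\<forall>\<^sub>F s in at_top. ((\<lambda>s. - f s) has_real_derivative - D s) (at s)"
      using der by eventually_elim (rule DERIV_minus)
    ultimately have "\<forall>\<^sub>F s in at_top. - f s < - a"
      using c by (intro eventually_less_of_descent)
    thus "\<forall>\<^sub>F s in at_top. a < f s" by simp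
  }
qed

lemma eventually_nonneg_of_decreasing_to_zero:
  fixes f D :: "real \<Rightarrow> real"
  assumes der: "\<forall>\<^sub>F s in at_top. (f has_real_derivative D s) (at s)"
    and neg: "\<forall>\<^sub>F s in at_top. D s \<le> 0"
    and lim: "(f \<longlongrightarrow> 0) at_top"
  shows "\<forall>\<^sub>F s in at_top. 0 \<le> f s"
proof -
  from eventually_conj[OF der neg] obtain N where
    N: "\<And>s. s \<ge> N \<Longrightarrow> (f has_real_derivative D s) (at s) \<and> D s \<le> 0"
    by (auto simp: eventually_at_top_linorder)
  have "0 \<le> f s" if s: "s \<ge> N" for s
  proof (rule tendsto_upperbound[OF lim])
    have "f t \<le> f s" if "t \<ge> s" for t
      using that N s by (intro DERIV_nonpos_imp_nonincreasing[of s t f]) (auto intro: order_trans)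
    thus "\<forall>\<^sub>F t in at_top. f t \<le> f s" by (auto simp: eventually_at_top_linorder)
  qed simp
  thus ?thesis by (auto simp: eventually_at_top_linorder)
qed

text \<open>A comparison in the spirit of l'Hopital: subtracting
  \<open>r * s powr (- \<tau>)\<close> with \<open>r \<noteq> a\<close> from \<open>v s - L\<close>
  leaves a function that is eventually monotone and tends to zero, hence has a definite sign.
  Letting \<open>r\<close> approach \<open>a\<close> from both sides squeezes the remainder.\<close>

lemma tendsto_remainder_of_derivative:
  fixes v D :: "real \<Rightarrow> real"
  assumes der: "\<forall>\<^sub>F s in at_top. (v has_real_derivative D s) (at s)"
    and v: "(v \<longlongrightarrow> L) at_top"
    and D: "((\<lambda>s. s powr \<tau> * (s * D s)) \<longlongrightarrow> - \<tau> * a) at_top"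
    and \<tau>: "\<tau> > 0"
  shows "((\<lambda>s. s powr \<tau> * (v s - L)) \<longlongrightarrow> a) at_top"
proof -
  \<comment> \<open>The factor \<open>j\<close> serves as a sign: one argument yields the lower
    bound (\<open>r < a\<close>, \<open>j = 1\<close>) and the upper bound (\<open>r > a\<close>,
    \<open>j = - 1\<close>).\<close>
  have nn: "\<forall>\<^sub>F s in at_top. 0 \<le> j * (v s - L - r * s powr (- \<tau>))"
    if jr: "j * (a - r) > 0" for j r
  proof (rule eventually_nonneg_of_decreasing_to_zero)
    show "\<forall>\<^sub>F s in at_top. ((\<lambda>s. j * (v s - L - r * s powr (- \<tau>))) has_real_derivative
            j * (D s - r * (- \<tau> * s powr (- \<tau> - 1)))) (at s)"
      using der eventually_gt_at_top[of 0]
      by eventually_elim (auto intro!: derivative_eq_intros)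
    have "((\<lambda>s. j * (v s - L - r * s powr (- \<tau>))) \<longlongrightarrow> j * (L - L - r * 0)) at_top"
      using \<tau> by (intro tendsto_intros v tendsto_neg_powr filterlim_ident) auto
    thus "((\<lambda>s. j * (v s - L - r * s powr (- \<tau>))) \<longlongrightarrow> 0) at_top" by simp
    have "((\<lambda>s. j * (s powr \<tau> * (s * D s) + \<tau> * r)) \<longlongrightarrow> j * (- \<tau> * a + \<tau> * r)) at_top"
      by (intro tendsto_intros D)
    moreover have "j * (- \<tau> * a + \<tau> * r) < 0"
    proof -
      have "j * (- \<tau> * a + \<tau> * r) = - (\<tau> * (j * (a - r)))" by (simp add: algebra_simps)
      thus ?thesis using \<tau> jr by (simp add: mult_pos_pos)
    qed
    ultimately have "\<forall>\<^sub>F s in at_top. j * (s powr \<tau> * (s * D s) + \<tau> * r) < 0"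
      by (rule order_tendstoD(2))
    thus "\<forall>\<^sub>F s in at_top. j * (D s - r * (- \<tau> * s powr (- \<tau> - 1))) \<le> 0"
      using eventually_gt_at_top[of 0]
    proof eventually_elim
      case (elim s)
      have "j * (D s - r * (- \<tau> * s powr (- \<tau> - 1)))
          = j * (s powr \<tau> * (s * D s) + \<tau> * r) / (s powr \<tau> * s)"
        using elim(2) by (simp add: powr_diff powr_minus field_simps)
      thus ?case using elim by (simp add: divide_nonpos_pos)
    qed
  qed
  show ?thesis
  proof (rule tendstoI)
    fix e :: real assume e: "e > 0"
    have "\<forall>\<^sub>F s in at_top. 0 \<le> 1 * (v s - L - (a - e / 2) * s powr (- \<tau>))"
      "\<forall>\<^sub>F s in at_top. 0 \<le> - 1 * (v s - L - (a + e / 2) * s powr (- \<tau>))"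
      using e by (intro nn; simp)+
    thus "\<forall>\<^sub>F s in at_top. dist (s powr \<tau> * (v s - L)) a < e"
      using eventually_gt_at_top[of 0]
    proof eventually_elim
      case (elim s)
      have P: "s powr \<tau> > 0" "s powr (- \<tau>) = 1 / s powr \<tau>"
        using elim by (auto simp: powr_minus_divide)
      have "a - e / 2 \<le> s powr \<tau> * (v s - L)" "s powr \<tau> * (v s - L) \<le> a + e / 2"
        using elim P by (auto simp: field_simps)
      thus ?case using e by (auto simp: dist_real_def abs_if)
    qed
  qed
qed

text \<open>\<open>\<eta>\<close> and \<open>\<omega>\<close> stand for \<open>\<theta>'\<close> and \<open>((\<theta>')\<^sup>k)'\<close>; the source \<open>\<kappa> \<theta>\<close> is written \<open>b p \<theta>\<close>.\<close>

locale slowly_decaying_solution =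
  fixes k :: nat and b c \<delta> p q L :: real and \<theta> \<eta> \<omega> :: "real \<Rightarrow> real"
  assumes k: "odd k" and b: "b > 0" and \<delta>: "\<delta> \<ge> 0" and p: "p > 0" and q: "q > 1" and L: "L > 0"
    and deriv_\<theta>: "\<And>s. s > 0 \<Longrightarrow> (\<theta> has_real_derivative \<eta> s) (at s)"
    and deriv_flux: "\<And>s. s > 0 \<Longrightarrow> ((\<lambda>s. \<eta> s ^ k) has_real_derivative \<omega> s) (at s)"
    and ode: "\<And>s. s > 0 \<Longrightarrow> \<omega> s =
      - (\<delta> * \<eta> s ^ k / s) - b * s * \<eta> s - b * p * \<theta> s - c * \<bar>\<theta> s\<bar> powr (q - 1) * \<theta> s"
    and lim_\<theta>: "((\<lambda>s. s powr p * \<theta> s) \<longlongrightarrow> L) at_top"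
begin

section \<open>Rescaled variables, exponents and the source term\<close>

definition v where "v s = s powr p * \<theta> s"
definition y where "y s = s powr p * s * \<eta> s"
text \<open>The two competing orders: inside the bracket of the equation for \<open>y s ^ k\<close>,
  the term with \<open>K\<close> carries the factor \<open>s powr (- \<nu>)\<close> and the
  nonlinearity the factor \<open>s powr (- \<sigma>)\<close>.\<close>

definition \<nu> where "\<nu> = (real k - 1) * p + real k + 1"
definition \<sigma> where "\<sigma> = p * (q - 1)"
definition g where "g s = s powr (\<nu> - 1)"
text \<open>\<open>real k * (p + 1)\<close> comes from differentiating the weight
  \<open>(s powr p * s) ^ k\<close>, and \<open>- \<delta>\<close> from the term
  \<open>\<delta> * \<eta> s ^ k / s\<close> of the equation.\<close>

definition K where "K = real k * (p + 1) - \<delta>"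

lemma k_pos: "k > 0"
  using k by (cases k) auto

lemma \<sigma>_pos: "\<sigma> > 0"
  using p q by (simp add: \<sigma>_def)

lemma \<nu>_gt_1: "\<nu> > 1"
  using p k_pos by (simp add: \<nu>_def add_nonneg_pos)

lemma \<nu>_pos: "\<nu> > 0"
  using \<nu>_gt_1 by simp

lemma lim_v: "(v \<longlongrightarrow> L) at_top"
  using lim_\<theta> by (simp add: v_def[abs_def])

lemma eventually_v_pos: "\<forall>\<^sub>F s in at_top. v s > 0"
  by (rule order_tendstoD(1)[OF lim_v L])

lemma g_ge_1: "\<forall>\<^sub>F s in at_top. g s \<ge> 1"
  using eventually_ge_at_top[of 1]
  by eventually_elim (use \<nu>_gt_1 in \<open>simp add: g_def ge_one_powr_ge_zero\<close>)

text \<open>The flux equation is multiplied by the weight \<open>(s powr p * s) ^ k\<close> of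
  \<open>y s ^ k\<close>. Keeping one factor \<open>s powr p\<close> inside the bracket turns
  \<open>b * s * \<eta> s\<close> into \<open>b * y s\<close>; what remains outside is
  \<open>g s\<close>.\<close>

lemma g_eq:
  assumes "s > 0"
  shows "g s = (s powr p * s) ^ k / s powr p"
proof -
  have "(s powr p * s) ^ k = (s powr (p + 1)) ^ k"
    using assms by (simp add: powr_add)
  also have "\<dots> = s powr (real k * (p + 1))"
    using assms by (simp add: powr_power mult.commute)
  finally have "(s powr p * s) ^ k / s powr p = s powr (real k * (p + 1) - p)"
    by (simp add: powr_diff)
  also have "real k * (p + 1) - p = \<nu> - 1" by (simp add: \<nu>_def algebra_simps)
  finally show ?thesis by (simp add: g_def)
qed

text \<open>Positivity of \<open>v s\<close> removes the absolute value, and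
  \<open>\<theta> s powr q\<close> then scales like \<open>s powr (- p * q)\<close>; the surplus
  exponent \<open>p - p * q\<close> is \<open>- \<sigma>\<close>.\<close>

lemma nonlinearity_eq:
  assumes "s > 0" "v s > 0"
  shows "s powr p * (\<bar>\<theta> s\<bar> powr (q - 1) * \<theta> s) = s powr (- \<sigma>) * v s powr q"
proof -
  have \<theta>: "\<theta> s = s powr (- p) * v s"
    using assms by (simp add: v_def powr_minus)
  have "\<theta> s > 0" using assms by (simp add: \<theta>)
  hence "\<bar>\<theta> s\<bar> powr (q - 1) * \<theta> s = \<theta> s powr q"
    by (simp add: powr_mult_base[of "\<theta> s" "q - 1"] mult.commute)
  also have "\<dots> = s powr (- p * q) * v s powr q"
    using assms by (simp add: \<theta> powr_mult powr_powr)
  finally show ?thesis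
    using assms by (simp add: \<sigma>_def algebra_simps flip: powr_add)
qed

lemma lim_nonlinearity:
  "((\<lambda>s. s powr (- \<sigma>) * v s powr q) \<longlongrightarrow> 0) at_top"
proof -
  have "((\<lambda>s. s powr (- \<sigma>) * v s powr q) \<longlongrightarrow> 0 * L powr q) at_top"
    using \<sigma>_pos L by (intro tendsto_intros tendsto_neg_powr lim_v filterlim_ident) auto
  thus ?thesis by simp
qed

lemma lim_source:
  "((\<lambda>s. s powr p * (b * p * \<theta> s + c * \<bar>\<theta> s\<bar> powr (q - 1) * \<theta> s)) \<longlongrightarrow> b * p * L) at_top"
proof (rule Lim_transform_eventually)
  show "((\<lambda>s. b * p * v s + c * (s powr (- \<sigma>) * v s powr q)) \<longlongrightarrow> b * p * L) at_top"
    using tendsto_add[OF tendsto_mult_left[OF lim_v] tendsto_mult_left[OF lim_nonlinearity]]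
    by simp
  show "\<forall>\<^sub>F s in at_top. b * p * v s + c * (s powr (- \<sigma>) * v s powr q)
      = s powr p * (b * p * \<theta> s + c * \<bar>\<theta> s\<bar> powr (q - 1) * \<theta> s)"
    using eventually_v_pos eventually_gt_at_top[of 0]
    by eventually_elim (subst nonlinearity_eq[symmetric], simp_all add: v_def algebra_simps)
qed

section \<open>A priori bound on the slope\<close>

text \<open>Undoing the scaling costs a factor \<open>s powr (- p)\<close>, which vanishes. The
  barrier argument for \<open>\<eta>\<close> needs the source in this unscaled form.\<close>

lemma lim_source_0:
  "((\<lambda>s. b * p * \<theta> s + c * \<bar>\<theta> s\<bar> powr (q - 1) * \<theta> s) \<longlongrightarrow> 0) at_top"
proof (rule Lim_transform_eventually)
  have "((\<lambda>s. s powr (- p) * (s powr p * (b * p * \<theta> s + c * \<bar>\<theta> s\<bar> powr (q - 1) * \<theta> s)))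
      \<longlongrightarrow> 0 * (b * p * L)) at_top"
    using p by (intro tendsto_mult lim_source tendsto_neg_powr filterlim_ident) auto
  thus "((\<lambda>s. s powr (- p) * (s powr p * (b * p * \<theta> s + c * \<bar>\<theta> s\<bar> powr (q - 1) * \<theta> s)))
      \<longlongrightarrow> 0) at_top" by simp
  show "\<forall>\<^sub>F s in at_top. s powr (- p) * (s powr p * (b * p * \<theta> s + c * \<bar>\<theta> s\<bar> powr (q - 1) * \<theta> s))
      = b * p * \<theta> s + c * \<bar>\<theta> s\<bar> powr (q - 1) * \<theta> s"
    using eventually_gt_at_top[of 0]
    by eventually_elim (simp add: powr_minus)
qed

text \<open>Needed because for \<open>k > 1\<close> the linear term \<open>K y\<^sup>k / s\<close> in the equation for \<open>y\<^sup>k\<close> could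
  otherwise compete with the damping \<open>b y\<close>.\<close>

lemma deriv_bounded: "\<forall>\<^sub>F s in at_top. \<bar>\<eta> s\<bar> \<le> 1"
proof -
  \<comment> \<open>Taking \<open>j\<close> as a sign gives barriers for \<open>\<eta> s ^ k\<close>
    at \<open>1\<close> and at \<open>- 1\<close>.\<close>
  have side: "\<forall>\<^sub>F s in at_top. j * \<eta> s ^ k < 1" if j: "j = 1 \<or> j = -1" for j :: real
  proof (rule eventually_less_of_descent)
    show "\<forall>\<^sub>F s in at_top. ((\<lambda>s. j * \<eta> s ^ k) has_real_derivative j * \<omega> s) (at s)"
      using eventually_gt_at_top[of 0]
      by eventually_elim (intro DERIV_cmult deriv_flux)
    \<comment> \<open>At or beyond the barrier the damping contributes at most \<open>- b\<close>
      and the \<open>\<delta>\<close> term has a favourable sign; a source of size below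
      \<open>b / 2\<close> leaves descent at rate \<open>b / 2\<close>.\<close>
    show "b / 2 > 0" using b by simp
    from tendstoD[OF lim_source_0 this]
    show "\<forall>\<^sub>F s in at_top. 1 \<le> j * \<eta> s ^ k \<longrightarrow> j * \<omega> s \<le> - (b / 2)"
      using eventually_ge_at_top[of 1]
    proof eventually_elim
      case (elim s)
      show ?case
      proof
        assume 1: "1 \<le> j * \<eta> s ^ k"
        \<comment> \<open>As \<open>k\<close> is odd, the sign passes inside the power, and the
          monotone root turns the bound on the power into
          \<open>1 \<le> j * \<eta> s\<close>.\<close>
        have jk: "j * \<eta> s ^ k = (j * \<eta> s) ^ k"
          using j k by (auto simp: power_mult_distrib)
        have "1 \<le> j * \<eta> s"
          using 1 k_pos odd_real_root_power_cancel[OF k, of "j * \<eta> s"]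
            real_root_le_mono[of k 1 "(j * \<eta> s) ^ k"]
          unfolding jk by simp
        hence "b * 1 \<le> b * (s * (j * \<eta> s))"
          using b elim(2) mult_mono[of 1 s 1 "j * \<eta> s"] by (intro mult_left_mono) auto
        moreover have "0 \<le> \<delta> * (j * \<eta> s ^ k) / s"
          using \<delta> 1 elim(2) by simp
        moreover have "j * \<omega> s = - (\<delta> * (j * \<eta> s ^ k) / s) - b * (s * (j * \<eta> s))
            - j * (b * p * \<theta> s + c * \<bar>\<theta> s\<bar> powr (q - 1) * \<theta> s)"
          using elim(2) by (simp add: ode algebra_simps)
        moreover have "- j * (b * p * \<theta> s + c * \<bar>\<theta> s\<bar> powr (q - 1) * \<theta> s) \<le> b / 2"
          using elim(1) j by (auto simp: dist_real_def abs_if split: if_splits)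
        ultimately show "j * \<omega> s \<le> - (b / 2)" by simp
      qed
    qed
  qed
  from side[of 1, simplified] side[of "-1", simplified] show ?thesis
  proof eventually_elim
    case (elim s)
    have "\<bar>\<eta> s\<bar> ^ k < 1"
      using elim k by (auto simp: abs_if)
    thus ?case by (metis k_pos less_imp_le not_le one_le_power order_less_le_trans not_less)
  qed
qed

text \<open>This is the coefficient of \<open>y s\<close> in \<open>K * y s ^ k / s\<close> after
  \<open>g s\<close> is factored out. The bound on \<open>\<eta>\<close> makes it vanish before
  anything is known about the size of \<open>y\<close>.\<close>

lemma lim_correction: "((\<lambda>s. K * \<eta> s ^ (k - 1) / s ^ 2) \<longlongrightarrow> 0) at_top"
proof (rule Lim_null_comparison)
  show "\<forall>\<^sub>F s in at_top. norm (K * \<eta> s ^ (k - 1) / s ^ 2) \<le> \<bar>K\<bar> * s powr (- 2)"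
    using deriv_bounded eventually_gt_at_top[of 0]
  proof eventually_elim
    case (elim s)
    have "\<bar>K\<bar> * \<bar>\<eta> s\<bar> ^ (k - 1) \<le> \<bar>K\<bar> * 1"
      using elim by (intro mult_left_mono power_le_one) auto
    thus ?case using elim(2)
      by (simp add: abs_mult power_abs powr_minus_divide powr_realpow[of s 2, simplified]
          divide_right_mono)
  qed
  have "((\<lambda>s. \<bar>K\<bar> * s powr (- 2)) \<longlongrightarrow> \<bar>K\<bar> * 0) at_top"
    by (intro tendsto_intros tendsto_neg_powr filterlim_ident) auto
  thus "((\<lambda>s. \<bar>K\<bar> * s powr (- 2)) \<longlongrightarrow> 0) at_top" by simp
qed

section \<open>Limit of the rescaled slope\<close>

text \<open>The \<open>K\<close> term is written as a perturbation of the damping coefficient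
  \<open>b\<close>, so that the form required by \<open>tendsto_attracting_equilibrium\<close>
  appears.\<close>

definition y_pow_deriv where
  "y_pow_deriv s = g s * (- (s powr p * (b * p * \<theta> s + c * \<bar>\<theta> s\<bar> powr (q - 1) * \<theta> s))
      - (b - K * \<eta> s ^ (k - 1) / s ^ 2) * y s)"

text \<open>The product rule is applied to the weight and the flux \<open>\<eta> s ^ k\<close>,
  because only the flux, not \<open>\<eta>\<close> itself, is known to be differentiable.\<close>

lemma deriv_y_pow:
  assumes s: "s > 0"
  shows "((\<lambda>s. y s ^ k) has_real_derivative y_pow_deriv s) (at s)"
proof -
  define P where "P = s powr p"
  define F where "F = b * p * \<theta> s + c * \<bar>\<theta> s\<bar> powr (q - 1) * \<theta> s"
  have P: "P > 0" using s by (simp add: P_def)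
  obtain m where m: "k = Suc m" using k_pos by (cases k) auto
  have m': "k - 1 = m" by (simp add: m)
  have "((\<lambda>s. s powr p * s) has_real_derivative (p + 1) * P) (at s)"
    using s by (auto intro!: derivative_eq_intros simp: P_def powr_diff algebra_simps)
  hence "((\<lambda>s. (s powr p * s) ^ k) has_real_derivative real k * ((p + 1) * P * (P * s) ^ m)) (at s)"
    using DERIV_power[of _ _ _ _ k] by (fastforce simp: P_def m)
  hence "((\<lambda>s. (s powr p * s) ^ k * \<eta> s ^ k) has_real_derivative
      real k * ((p + 1) * P * (P * s) ^ m) * \<eta> s ^ k + \<omega> s * (P * s) ^ k) (at s)"
    unfolding P_def by (rule DERIV_mult[OF _ deriv_flux[OF s]])
  moreover have "(\<lambda>s. (s powr p * s) ^ k * \<eta> s ^ k) = (\<lambda>s. y s ^ k)"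
    by (simp add: y_def power_mult_distrib)
  moreover have "real k * ((p + 1) * P * (P * s) ^ m) * \<eta> s ^ k + \<omega> s * (P * s) ^ k = y_pow_deriv s"
  proof -
    have \<omega>: "\<omega> s = - (\<delta> * \<eta> s ^ k / s) - b * s * \<eta> s - F"
      using ode[OF s] by (simp add: F_def)
    have k_pow: "x ^ k = x * x ^ m" for x :: real by (simp add: m)
    have "y_pow_deriv s = (P * s) ^ k / P *
        (- (P * F) - (b - K * \<eta> s ^ m / s ^ 2) * (P * s * \<eta> s))"
      unfolding y_pow_deriv_def m' g_eq[OF s] F_def P_def y_def by simp
    also have "\<dots> = real k * ((p + 1) * P * (P * s) ^ m) * \<eta> s ^ k + \<omega> s * (P * s) ^ k"
      unfolding \<omega> K_def k_pow using s P
      by (simp add: field_simps power2_eq_square)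
    finally show ?thesis ..
  qed
  ultimately show ?thesis by simp
qed

lemma root_y_pow: "root k (y s ^ k) = y s"
  using k by (rule odd_real_root_power_cancel)

text \<open>With \<open>f = y^k\<close> and \<open>\<phi> = root k\<close> the damping is linear in
  \<open>y\<close>, so the equilibrium solves \<open>b * y = - (b * p * L)\<close>. Continuity of
  the root then passes from \<open>y^k\<close> back to \<open>y\<close>.\<close>

lemma lim_y: "(y \<longlongrightarrow> - (p * L)) at_top"
proof -
  have "((\<lambda>s. y s ^ k) \<longlongrightarrow> (- (p * L)) ^ k) at_top"
  proof (rule tendsto_attracting_equilibrium)
    show "\<forall>\<^sub>F s in at_top. ((\<lambda>s. y s ^ k) has_real_derivative y_pow_deriv s) (at s)"
      using eventually_gt_at_top[of 0] by eventually_elim (rule deriv_y_pow)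
    show "\<forall>\<^sub>F s in at_top. y_pow_deriv s = g s *
        (- (s powr p * (b * p * \<theta> s + c * \<bar>\<theta> s\<bar> powr (q - 1) * \<theta> s))
          - (b - K * \<eta> s ^ (k - 1) / s ^ 2) * root k (y s ^ k))"
      by (simp add: root_y_pow y_pow_deriv_def)
    show "\<forall>\<^sub>F s in at_top. g s \<ge> 1" by (rule g_ge_1)
    show "((\<lambda>s. b - K * \<eta> s ^ (k - 1) / s ^ 2) \<longlongrightarrow> b) at_top"
      using tendsto_diff[OF tendsto_const[of b] lim_correction] by simp
    show "b > 0" by (rule b)
    show "((\<lambda>s. - (s powr p * (b * p * \<theta> s + c * \<bar>\<theta> s\<bar> powr (q - 1) * \<theta> s)))
        \<longlongrightarrow> b * root k ((- (p * L)) ^ k)) at_top"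
      using tendsto_minus[OF lim_source] odd_real_root_power_cancel[OF k, of "- (p * L)"]
      by (simp add: mult.assoc)
    show "strict_mono (root k)"
      using k_pos by (simp add: strict_mono_def)
  qed
  from tendsto_real_root[OF this, of k] show ?thesis
    using odd_real_root_power_cancel[OF k, of "- (p * L)"] by (simp add: root_y_pow)
qed

section \<open>The next-order expansion\<close>

lemma deriv_v:
  assumes "s > 0"
  shows "(v has_real_derivative (y s + p * v s) / s) (at s)"
  unfolding v_def[abs_def] y_def
  using assms deriv_\<theta>[OF assms]
  by (auto intro!: derivative_eq_intros simp: powr_diff field_simps)

text \<open>\<open>root k\<close> is differentiable away from zero, so \<open>y\<close> inherits a
  derivative from \<open>y^k\<close> there; \<open>lim_y\<close> places large \<open>s\<close> in
  this case.\<close>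

lemma deriv_y:
  assumes "s > 0" "y s \<noteq> 0"
  shows "(y has_real_derivative y_pow_deriv s / (real k * y s ^ (k - 1))) (at s)"
  using DERIV_chain2[OF DERIV_odd_real_root[OF k, of "y s ^ k"] deriv_y_pow[OF assms(1)]] assms(2)
  by (simp add: root_y_pow divide_inverse mult.commute)

text \<open>Coefficients of \<open>E' = g * (\<gamma> - \<beta> * E)\<close> for
  \<open>E = s powr \<tau> * (y s + p * v s)\<close>. The divisor comes from passing from
  \<open>y^k\<close> to \<open>y\<close>; \<open>(\<tau> + p) * s powr (- \<nu>)\<close> collects
  the derivatives of \<open>s powr \<tau>\<close> and \<open>p * v s\<close>, as
  \<open>g s * s powr (- \<nu>) = 1 / s\<close>.\<close>

definition \<beta> where "\<beta> \<tau> s = b / (real k * y s ^ (k - 1)) - (\<tau> + p) * s powr (- \<nu>)"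
definition \<gamma> where "\<gamma> \<tau> s = (K * y s ^ k * s powr (\<tau> - \<nu>) - c * s powr (\<tau> - \<sigma>) * v s powr q)
  / (real k * y s ^ (k - 1))"

text \<open>Expressing \<open>\<eta>\<close> through \<open>y\<close>, whose limit is now known,
  shows the explicit order \<open>s powr (- \<nu>)\<close> of the correction.\<close>

lemma correction_eq:
  assumes s: "s > 0"
  shows "K * \<eta> s ^ (k - 1) / s ^ 2 * y s = K * y s ^ k * s powr (- \<nu>)"
proof -
  define P where "P = s powr p"
  have P: "P > 0" using s by (simp add: P_def)
  obtain m where m: "k = Suc m" using k_pos by (cases k) auto
  have "s powr (- \<nu>) = 1 / (s * g s)"
    using s by (simp add: g_def powr_diff powr_minus_divide)
  also have "\<dots> = P / (s * (P * s) ^ k)"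
    by (simp add: g_eq[OF s] P_def)
  also have "\<dots> = 1 / (s ^ 2 * (P * s) ^ m)"
    using P s by (simp add: m field_simps power2_eq_square)
  finally have "s powr (- \<nu>) = 1 / (s ^ 2 * (P * s) ^ m)" .
  moreover have "y s = P * s * \<eta> s" by (simp add: y_def P_def)
  ultimately show ?thesis
    using P s by (simp add: m power_mult_distrib field_simps)
qed

text \<open>The limits \<open>i\<close> and \<open>j\<close>, which are \<open>0\<close> or \<open>1\<close> for \<open>\<tau> = min \<nu> \<sigma>\<close>, select the dominant terms.\<close>

lemma lim_rescaled_slope:
  assumes i: "((\<lambda>s. s powr (\<tau> - \<sigma>)) \<longlongrightarrow> i) at_top"
    and j: "((\<lambda>s. s powr (\<tau> - \<nu>)) \<longlongrightarrow> j) at_top"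
  shows "((\<lambda>s. s powr \<tau> * (y s + p * v s)) \<longlongrightarrow>
    - (K * (p * L) ^ k * j + c * i * L powr q) / b) at_top"
proof -
  have y_neg: "\<forall>\<^sub>F s in at_top. y s < 0"
    using p L by (intro order_tendstoD(2)[OF lim_y]) simp
  define M where "M = real k * (- (p * L)) ^ (k - 1)"
  \<comment> \<open>The exponent \<open>k - 1\<close> is even, so the limiting damping
    \<open>b / M\<close> is positive although \<open>y\<close> tends to a negative number.\<close>
  have "(- (p * L)) ^ (k - 1) > 0"
    using k p L by (simp add: zero_less_power_eq)
  hence M: "M > 0" using k_pos by (simp add: M_def)
  have lim_M: "((\<lambda>s. real k * y s ^ (k - 1)) \<longlongrightarrow> M) at_top"
    unfolding M_def by (intro tendsto_intros lim_y)
  define D where "D s = g s * (\<gamma> \<tau> s - \<beta> \<tau> s * (s powr \<tau> * (y s + p * v s)))" for s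
  show ?thesis
  proof (rule tendsto_attracting_equilibrium[where D = D and g = g
        and \<gamma> = "\<gamma> \<tau>" and \<beta> = "\<beta> \<tau>" and \<phi> = "\<lambda>x. x"])
    show "\<forall>\<^sub>F s in at_top. ((\<lambda>s. s powr \<tau> * (y s + p * v s)) has_real_derivative D s) (at s)"
      using eventually_gt_at_top[of 0] eventually_v_pos y_neg
    proof eventually_elim
      case (elim s)
      define x where "x = y s + p * v s"
      define Y where "Y = real k * y s ^ (k - 1)"
      define N where "N = s powr (- \<sigma>) * v s powr q"
      have Y: "Y \<noteq> 0" using elim k_pos by (simp add: Y_def)
      have s\<nu>: "s powr (- \<nu>) = 1 / (s * g s)" "g s \<noteq> 0"
        using elim by (auto simp: g_def powr_diff powr_minus_divide)
      have F: "s powr p * (b * p * \<theta> s + c * \<bar>\<theta> s\<bar> powr (q - 1) * \<theta> s) = b * p * v s + c * N"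
        using nonlinearity_eq[OF elim(1,2)] by (simp add: v_def N_def algebra_simps)
      \<comment> \<open>The leading source \<open>b * p * v s\<close> and the damping
        \<open>b * y s\<close> merge into \<open>b * x\<close>, leaving only terms of orders \<nu>
        and \<sigma> as forcing.\<close>
      have z: "y_pow_deriv s = g s * (K * y s ^ k * s powr (- \<nu>) - c * N - b * x)"
        unfolding y_pow_deriv_def F x_def correction_eq[OF elim(1), symmetric]
        by (simp add: algebra_simps)
      have "((\<lambda>s. s powr \<tau> * (y s + p * v s)) has_real_derivative
          \<tau> * s powr (\<tau> - 1) * x + (y_pow_deriv s / Y + p * (x / s)) * s powr \<tau>) (at s)"
        unfolding x_def Y_def using elim
        by (intro DERIV_mult DERIV_add DERIV_cmult deriv_v deriv_y has_real_derivative_powr) auto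
      moreover have "\<tau> * s powr (\<tau> - 1) * x + (y_pow_deriv s / Y + p * (x / s)) * s powr \<tau> = D s"
      proof -
        have "D s = g s * (s powr \<tau> * (K * y s ^ k * s powr (- \<nu>) - c * N) / Y
            - (b / Y - (\<tau> + p) * s powr (- \<nu>)) * (s powr \<tau> * x))"
          by (simp add: D_def \<gamma>_def \<beta>_def powr_diff powr_minus_divide N_def Y_def x_def
              algebra_simps)
        also have "\<dots> = g s * s powr \<tau> * (K * y s ^ k * s powr (- \<nu>) - c * N - b * x) / Y
            + (\<tau> + p) * x * s powr \<tau> * (g s * s powr (- \<nu>))"
          using Y by (simp add: field_simps)
        also have "g s * s powr (- \<nu>) = 1 / s" using s\<nu> by simp
        finally show ?thesis
          using elim(1) Y by (simp add: z powr_diff field_simps)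
      qed
      ultimately show ?case by simp
    qed
    show "\<forall>\<^sub>F s in at_top. D s = g s * (\<gamma> \<tau> s - \<beta> \<tau> s * (s powr \<tau> * (y s + p * v s)))"
      by (simp add: D_def)
    show "\<forall>\<^sub>F s in at_top. g s \<ge> 1" by (rule g_ge_1)
    have "(\<beta> \<tau> \<longlongrightarrow> b / M - (\<tau> + p) * 0) at_top"
      unfolding \<beta>_def[abs_def] using \<nu>_pos M
      by (intro tendsto_intros lim_M tendsto_neg_powr filterlim_ident) auto
    thus "(\<beta> \<tau> \<longlongrightarrow> b / M) at_top" by simp
    show "b / M > 0" using b M by simp
    have "(\<gamma> \<tau> \<longlongrightarrow> (K * (- (p * L)) ^ k * j - c * i * L powr q) / M) at_top"
      unfolding \<gamma>_def[abs_def] using M L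
      by (intro tendsto_intros lim_M lim_y lim_v i j) auto
    \<comment> \<open>Oddness of \<open>k\<close> pulls the sign out of the power, and
      \<open>M\<close> cancels from the equilibrium.\<close>
    moreover have "(K * (- (p * L)) ^ k * j - c * i * L powr q) / M
        = b / M * (- (K * (p * L) ^ k * j + c * i * L powr q) / b)"
      using b M k by (simp add: field_simps)
    ultimately show "(\<gamma> \<tau> \<longlongrightarrow> b / M * (- (K * (p * L) ^ k * j + c * i * L powr q) / b)) at_top"
      by simp
    show "strict_mono (\<lambda>x::real. x)" by (simp add: strict_mono_def)
  qed
qed

text \<open>The condition on \<open>a\<close> says that the limit in
  \<open>lim_rescaled_slope\<close> is \<open>- \<tau> * a\<close>, which is what a remainder
  \<open>a * s powr (- \<tau>)\<close> of \<open>v\<close> produces.\<close>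

lemma first_order_expansion:
  assumes i: "((\<lambda>s. s powr (\<tau> - \<sigma>)) \<longlongrightarrow> i) at_top"
    and j: "((\<lambda>s. s powr (\<tau> - \<nu>)) \<longlongrightarrow> j) at_top"
    and \<tau>: "\<tau> > 0"
    and a: "b * \<tau> * a = K * (p * L) ^ k * j + c * i * L powr q"
  shows "\<exists>e. e \<in> o[at_top](\<lambda>_. 1) \<and> (\<forall>\<^sub>F s in at_top.
      \<theta> s = s powr (- p) * (L + (a + e s) * s powr (- \<tau>)))"
    and "\<exists>e. e \<in> o[at_top](\<lambda>_. 1) \<and> (\<forall>\<^sub>F s in at_top.
      \<eta> s = - (s powr (- (p + 1))) * (p * L + (p + \<tau>) * (a + e s) * s powr (- \<tau>)))"
proof -
  have "- (K * (p * L) ^ k * j + c * i * L powr q) / b = - \<tau> * a"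
    unfolding a[symmetric] using b by simp
  hence E: "((\<lambda>s. s powr \<tau> * (y s + p * v s)) \<longlongrightarrow> - \<tau> * a) at_top"
    using lim_rescaled_slope[OF i j] by simp
  have D: "((\<lambda>s. s powr \<tau> * (v s - L)) \<longlongrightarrow> a) at_top"
  proof (rule tendsto_remainder_of_derivative)
    show "\<forall>\<^sub>F s in at_top. (v has_real_derivative (y s + p * v s) / s) (at s)"
      using eventually_gt_at_top[of 0] by eventually_elim (rule deriv_v)
    show "((\<lambda>s. s powr \<tau> * (s * ((y s + p * v s) / s))) \<longlongrightarrow> - \<tau> * a) at_top"
      by (rule Lim_transform_eventually[OF E])
        (use eventually_gt_at_top[of 0] in \<open>eventually_elim, simp\<close>)
  qed (use lim_v \<tau> in auto)
  define e1 where "e1 s = s powr \<tau> * (v s - L) - a" for s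
  have "(e1 \<longlongrightarrow> a - a) at_top"
    unfolding e1_def by (intro tendsto_intros D)
  hence "e1 \<in> o[at_top](\<lambda>_. 1)" by (intro smalloI_tendsto) auto
  moreover have "\<forall>\<^sub>F s in at_top. \<theta> s = s powr (- p) * (L + (a + e1 s) * s powr (- \<tau>))"
    using eventually_gt_at_top[of 0]
    by eventually_elim (simp add: e1_def v_def powr_minus field_simps)
  ultimately show "\<exists>e. e \<in> o[at_top](\<lambda>_. 1) \<and> (\<forall>\<^sub>F s in at_top.
      \<theta> s = s powr (- p) * (L + (a + e s) * s powr (- \<tau>)))" by blast
  \<comment> \<open>Solved from
    \<open>(p + \<tau>) * (a + e2 s) = s powr \<tau> * (- y s - p * L)\<close>, with the right side
    split into the two quantities whose limits are known.\<close>
  define e2 where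
    "e2 s = (p * (s powr \<tau> * (v s - L)) - s powr \<tau> * (y s + p * v s)) / (p + \<tau>) - a" for s
  have p\<tau>: "p + \<tau> > 0" using p \<tau> by simp
  have "(e2 \<longlongrightarrow> (p * a - - \<tau> * a) / (p + \<tau>) - a) at_top"
    unfolding e2_def using p\<tau> by (intro tendsto_intros D E) auto
  moreover have "(p * a - - \<tau> * a) / (p + \<tau>) - a = 0"
    using p\<tau> by (simp add: field_simps)
  ultimately have "e2 \<in> o[at_top](\<lambda>_. 1)" by (intro smalloI_tendsto) auto
  moreover have "\<forall>\<^sub>F s in at_top.
      \<eta> s = - (s powr (- (p + 1))) * (p * L + (p + \<tau>) * (a + e2 s) * s powr (- \<tau>))"
    using eventually_gt_at_top[of 0]
  proof eventually_elim
    case (elim s)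
    have "(p + \<tau>) * (a + e2 s) = p * (s powr \<tau> * (v s - L)) - s powr \<tau> * (y s + p * v s)"
      using p\<tau> by (simp add: e2_def)
    also have "\<dots> = s powr \<tau> * (- y s - p * L)"
      by (simp add: algebra_simps)
    finally have "(p + \<tau>) * (a + e2 s) * s powr (- \<tau>) = - y s - p * L"
      using elim by (simp add: powr_minus)
    thus ?case
      using elim by (simp add: y_def powr_diff powr_minus_divide)
  qed
  ultimately show "\<exists>e. e \<in> o[at_top](\<lambda>_. 1) \<and> (\<forall>\<^sub>F s in at_top.
      \<eta> s = - (s powr (- (p + 1))) * (p * L + (p + \<tau>) * (a + e s) * s powr (- \<tau>)))" by blast
qed

end

section \<open>The original parameters and the three regimes\<close>

theorem proposition5p3:
  fixes n k :: nat and q \<kappa> L :: real and \<theta> :: "real \<Rightarrow> real"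
  assumes "n > 2" and "1 \<le> k" and "k \<le> n" and "odd k"
    and "q > real k" and "\<kappa> > 0"
    and "is_solution n k q \<kappa> \<theta>"
    and "((\<lambda>s. s powr kappa_tilde k \<kappa> * \<theta> s) \<longlongrightarrow> L) at_top"
    and "L > 0"
  shows
    "((\<lambda>s. s powr (kappa_tilde k \<kappa> + 1) * deriv \<theta> s) \<longlongrightarrow> - kappa_tilde k \<kappa> * L) at_top
    \<and> ((q - real k) * kappa_tilde k \<kappa> > real k + 1 \<longrightarrow>
        (\<exists>e. e \<in> o[at_top](\<lambda>_. 1) \<and> (\<forall>\<^sub>F s in at_top.
          \<theta> s = s powr (- kappa_tilde k \<kappa>) *
            (L + (A_tilde n k \<kappa> L + e s) * s powr (- nu_tilde k \<kappa>)))))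
    \<and> ((q - real k) * kappa_tilde k \<kappa> = real k + 1 \<longrightarrow>
        (\<exists>e. e \<in> o[at_top](\<lambda>_. 1) \<and> (\<forall>\<^sub>F s in at_top.
          \<theta> s = s powr (- kappa_tilde k \<kappa>) *
            (L + (A_tilde n k \<kappa> L + B_tilde n k q \<kappa> L + e s)
                   * s powr (- kappa_tilde k \<kappa> * (q - 1))))))
    \<and> ((q - real k) * kappa_tilde k \<kappa> < real k + 1 \<longrightarrow>
        (\<exists>e. e \<in> o[at_top](\<lambda>_. 1) \<and> (\<forall>\<^sub>F s in at_top.
          \<theta> s = s powr (- kappa_tilde k \<kappa>) *
            (L + (B_tilde n k q \<kappa> L + e s) * s powr (- kappa_tilde k \<kappa> * (q - 1))))))
    \<and> ((q - real k) * kappa_tilde k \<kappa> > real k + 1 \<longrightarrow>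
        (\<exists>e. e \<in> o[at_top](\<lambda>_. 1) \<and> (\<forall>\<^sub>F s in at_top.
          deriv \<theta> s = - (s powr (- (kappa_tilde k \<kappa> + 1))) *
            (kappa_tilde k \<kappa> * L
              + (kappa_tilde k \<kappa> + nu_tilde k \<kappa>) * (A_tilde n k \<kappa> L + e s)
                  * s powr (- nu_tilde k \<kappa>)))))
    \<and> ((q - real k) * kappa_tilde k \<kappa> = real k + 1 \<longrightarrow>
        (\<exists>e. e \<in> o[at_top](\<lambda>_. 1) \<and> (\<forall>\<^sub>F s in at_top.
          deriv \<theta> s = - (s powr (- (kappa_tilde k \<kappa> + 1))) *
            (kappa_tilde k \<kappa> * L
              + kappa_tilde k \<kappa> * q * (A_tilde n k \<kappa> L + B_tilde n k q \<kappa> L + e s)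
                  * s powr (- kappa_tilde k \<kappa> * (q - 1))))))
    \<and> ((q - real k) * kappa_tilde k \<kappa> < real k + 1 \<longrightarrow>
        (\<exists>e. e \<in> o[at_top](\<lambda>_. 1) \<and> (\<forall>\<^sub>F s in at_top.
          deriv \<theta> s = - (s powr (- (kappa_tilde k \<kappa> + 1))) *
            (kappa_tilde k \<kappa> * L
              + kappa_tilde k \<kappa> * q * (B_tilde n k q \<kappa> L + e s)
                  * s powr (- kappa_tilde k \<kappa> * (q - 1))))))"
proof -
  define p where "p = kappa_tilde k \<kappa>"
  define b where "b = b_coeff k"
  define c where "c = inverse (c_coeff n k)"
  define \<delta> where "\<delta> = delta_exp n k"
  have b: "b > 0" using assms(2) by (simp add: b_def b_coeff_def)
  have p: "p > 0" using assms(6) b by (simp add: p_def kappa_tilde_def b_def)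
  have \<kappa>: "\<kappa> = b * p" using b by (simp add: p_def kappa_tilde_def b_def)
  have cc: "c_coeff n k > 0" using assms(1,3) by (simp add: c_coeff_def)
  have "2 * real k \<le> real n * (real k + 1)"
    using mult_mono[of 2 "real n" "real k" "real k + 1"] assms(1) by simp
  hence \<delta>: "\<delta> \<ge> 0" using assms(2) by (simp add: \<delta>_def delta_exp_def)
  have q: "q > 1" using assms(2,5) by linarith
  from assms(7) obtain D\<^sub>0 D where
    sol: "\<And>s. s > 0 \<Longrightarrow> (\<theta> has_real_derivative D\<^sub>0 s) (at s)"
      "\<And>s. s > 0 \<Longrightarrow> ((\<lambda>s. deriv \<theta> s ^ k) has_real_derivative D s) (at s)"
      "\<And>s. s > 0 \<Longrightarrow> deriv (\<lambda>t. t powr \<delta> * deriv \<theta> t ^ k) s + s powr \<delta> *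
            (b * s * deriv \<theta> s + \<kappa> * \<theta> s + c * \<bar>\<theta> s\<bar> powr (q - 1) * \<theta> s) = 0"
    unfolding is_solution_def C1_differentiable_on_def b_def c_def \<delta>_def
    by (simp add: has_real_derivative_iff_has_vector_derivative Ball_def) blast
  interpret slowly_decaying_solution k b c \<delta> p q L \<theta> "deriv \<theta>" D
  proof
    fix s :: real assume s: "s > 0"
    show "(\<theta> has_real_derivative deriv \<theta> s) (at s)"
      using sol(1)[OF s] DERIV_imp_deriv by metis
    show "((\<lambda>s. deriv \<theta> s ^ k) has_real_derivative D s) (at s)" using sol(2)[OF s] .
    \<comment> \<open>The product rule opens the divergence form; dividing by the positive weight
      \<open>s powr \<delta>\<close> gives the flux equation.\<close>
    have "((\<lambda>t. t powr \<delta> * deriv \<theta> t ^ k) has_real_derivative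
        \<delta> * s powr (\<delta> - 1) * deriv \<theta> s ^ k + D s * s powr \<delta>) (at s)"
      using s by (intro DERIV_mult sol(2) has_real_derivative_powr) auto
    from sol(3)[OF s, unfolded DERIV_imp_deriv[OF this]]
    have "s powr \<delta> * (D s + \<delta> * deriv \<theta> s ^ k / s + b * s * deriv \<theta> s + b * p * \<theta> s
        + c * \<bar>\<theta> s\<bar> powr (q - 1) * \<theta> s) = 0"
      using s by (simp add: \<kappa> powr_diff algebra_simps)
    hence "D s + \<delta> * deriv \<theta> s ^ k / s + b * s * deriv \<theta> s + b * p * \<theta> s
        + c * \<bar>\<theta> s\<bar> powr (q - 1) * \<theta> s = 0"
      using s by (simp only: mult_eq_0_iff powr_eq_0_iff) simp
    thus "D s = - (\<delta> * deriv \<theta> s ^ k / s) - b * s * deriv \<theta> s - b * p * \<theta> s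
        - c * \<bar>\<theta> s\<bar> powr (q - 1) * \<theta> s"
      by linarith
  qed (use assms b p \<delta> q in \<open>simp_all add: p_def\<close>)
  define A where "A = A_tilde n k \<kappa> L"
  define B where "B = B_tilde n k q \<kappa> L"
  have \<nu>: "\<nu> = nu_tilde k \<kappa>" by (simp add: \<nu>_def nu_tilde_def flip: p_def)
  have A: "b * \<nu> * A = K * (p * L) ^ k"
  proof -
    have "A = K * (p * L) ^ k / (b * \<nu>)"
      by (simp add: A_def A_tilde_def K_def n_tilde_def algebra_simps flip: \<nu> p_def b_def \<delta>_def)
    thus ?thesis using b \<nu>_pos by simp
  qed
  have B: "b * \<sigma> * B = c * L powr q"
    using b p q cc
    by (simp add: B_def B_tilde_def \<sigma>_def c_def field_simps flip: p_def b_def)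
  \<comment> \<open>The three regimes compare the orders \<sigma> and \<nu>: the smaller one
    dominates the remainder.\<close>
  have \<sigma>\<nu>: "\<sigma> - \<nu> = (q - real k) * p - (real k + 1)"
    by (simp add: \<sigma>_def \<nu>_def algebra_simps)
  have same: "((\<lambda>s. s powr (t - t)) \<longlongrightarrow> 1) at_top" for t :: real
    by (rule Lim_transform_eventually[OF tendsto_const])
      (use eventually_gt_at_top[of 0] in \<open>eventually_elim, simp\<close>)
  have smaller: "((\<lambda>s. s powr (t - r)) \<longlongrightarrow> 0) at_top" if "t < r" for t r :: real
    using that by (intro tendsto_neg_powr filterlim_ident) auto
  \<comment> \<open>\<open>p * q = p + \<sigma>\<close> identifies the coefficient in the expansion
    of the derivative with \<open>p + \<tau>\<close> for \<open>\<tau> = \<sigma>\<close>.\<close>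
  have \<sigma>': "- p * (q - 1) = - \<sigma>" "p * q = p + \<sigma>" by (simp_all add: \<sigma>_def algebra_simps)
  have lim: "((\<lambda>s. s powr (p + 1) * deriv \<theta> s) \<longlongrightarrow> - p * L) at_top"
  proof (rule Lim_transform_eventually)
    show "(y \<longlongrightarrow> - p * L) at_top" using lim_y by simp
    show "\<forall>\<^sub>F s in at_top. y s = s powr (p + 1) * deriv \<theta> s"
      using eventually_gt_at_top[of 0] by eventually_elim (simp add: y_def powr_add)
  qed
  \<comment> \<open>\<open>i\<close> switches on the nonlinear contribution \<open>B\<close> and
    \<open>j\<close> the contribution \<open>A\<close>; both survive when the orders agree.\<close>
  note gt = first_order_expansion[where \<tau> = \<nu> and i = 0 and j = 1 and a = A, OF smaller same \<nu>_pos]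
  note eq = first_order_expansion[where \<tau> = \<sigma> and i = 1 and j = 1 and a = "A + B",
      OF same _ \<sigma>_pos]
  note lt = first_order_expansion[where \<tau> = \<sigma> and i = 1 and j = 0 and a = B, OF same smaller \<sigma>_pos]
  show ?thesis
    unfolding p_def[symmetric] A_def[symmetric] B_def[symmetric] \<nu>[symmetric] \<sigma>'
  proof (intro conjI impI)
    show "((\<lambda>s. s powr (p + 1) * deriv \<theta> s) \<longlongrightarrow> - p * L) at_top" by (rule lim)
  next
    assume "(q - real k) * p > real k + 1"
    hence "\<nu> < \<sigma>" using \<sigma>\<nu> by simp
    note * = gt[OF this]
    show "\<exists>e. e \<in> o[at_top](\<lambda>_. 1) \<and> (\<forall>\<^sub>F s in at_top.
        \<theta> s = s powr (- p) * (L + (A + e s) * s powr (- \<nu>)))"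
      by (rule *) (use A in simp)
    show "\<exists>e. e \<in> o[at_top](\<lambda>_. 1) \<and> (\<forall>\<^sub>F s in at_top.
        deriv \<theta> s = - (s powr (- (p + 1))) * (p * L + (p + \<nu>) * (A + e s) * s powr (- \<nu>)))"
      by (rule *) (use A in simp)
  next
    assume "(q - real k) * p = real k + 1"
    hence "\<nu> = \<sigma>" using \<sigma>\<nu> by simp
    hence AB: "b * \<sigma> * (A + B) = K * (p * L) ^ k * 1 + c * 1 * L powr q"
      and one: "((\<lambda>s. s powr (\<sigma> - \<nu>)) \<longlongrightarrow> 1) at_top"
      using A B same by (simp_all add: algebra_simps)
    show "\<exists>e. e \<in> o[at_top](\<lambda>_. 1) \<and> (\<forall>\<^sub>F s in at_top.
        \<theta> s = s powr (- p) * (L + (A + B + e s) * s powr (- \<sigma>)))"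
      by (rule eq[OF one AB])
    show "\<exists>e. e \<in> o[at_top](\<lambda>_. 1) \<and> (\<forall>\<^sub>F s in at_top.
        deriv \<theta> s = - (s powr (- (p + 1))) * (p * L + (p + \<sigma>) * (A + B + e s) * s powr (- \<sigma>)))"
      by (rule eq[OF one AB])
  next
    assume "(q - real k) * p < real k + 1"
    hence "\<sigma> < \<nu>" using \<sigma>\<nu> by simp
    note * = lt[OF this]
    show "\<exists>e. e \<in> o[at_top](\<lambda>_. 1) \<and> (\<forall>\<^sub>F s in at_top.
        \<theta> s = s powr (- p) * (L + (B + e s) * s powr (- \<sigma>)))"
      by (rule *) (use B in simp)
    show "\<exists>e. e \<in> o[at_top](\<lambda>_. 1) \<and> (\<forall>\<^sub>F s in at_top.
        deriv \<theta> s = - (s powr (- (p + 1))) * (p * L + (p + \<sigma>) * (B + e s) * s powr (- \<sigma>)))"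
      by (rule *) (use B in simp)
  qed
qed

end
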